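(* Let $G=K_2$, let $\theta$ be a weight function with $\theta_{12}=\theta(p_1,p_2)$, and let $E(p_1,p_2)$ be a smooth function which is symmetric ($E(p_1,p_2)=E(p_2,p_1)$) and convex (concave upward) on $M=\{(p_1,p_2):p_1+p_2=1,\ p_1,p_2\ge 0\}$. Let $\kappa(p)$ denote the local Ricci curvature bound, given for $p$ in the interior of $M$ by $$\kappa(p)=\frac12\left(\frac{\partial\theta_{12}}{\partial p_1}-\frac{\partial\theta_{12}}{\partial p_2}\right)\left(\frac{\partial E}{\partial p_1}-\frac{\partial E}{\partial p_2}\right)+\theta_{12}\left(\frac{\partial^2E}{\partial p_1^2}-2\frac{\partial^2E}{\partial p_1\partial p_2}+\frac{\partial^2E}{\partial p_2^2}\right).$$ Then $\kappa$ is a constant $C$ if and only if $$\theta_{12}=2C\,\frac{E(p_1,p_2)-E(\frac12,\frac12)}{\left(\frac{\partial E}{\partial p_1}-\frac{\partial E}{\partial p_2}\right)^2}\quad\text{on } M.$$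
   Context: A weight function is $\theta:[0,\infty)^2\to[0,\infty)$, continuous, $C^\infty$ on $(0,\infty)^2$, symmetric and positive on $(0,\infty)^2$.
   Formalization: E is assumed non-constant on the interior of M (for constant E the quotient is 0/0 everywhere while κ=0), and where the quotient is undefined, as at (1/2,1/2) where it is 0/0 or at endpoints where E is not smooth, its value is taken to be its limit along M. *)

theory Defs
  imports "HOL-Analysis.Analysis"
begin

text \<open>\<open>C\<^sup>k\<close> and smooth maps on an open subset of a finite-dimensional space.\<close>

fun Ck_on :: "nat \<Rightarrow> ('a::euclidean_space \<Rightarrow> 'b::real_normed_vector) \<Rightarrow> 'a set \<Rightarrow> bool" where
  "Ck_on 0 f S \<longleftrightarrow> continuous_on S f"
| "Ck_on (Suc k) f S \<longleftrightarrow> (\<forall>x\<in>S. f differentiable (at x)) \<and>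
     (\<forall>v. Ck_on k (\<lambda>x. frechet_derivative f (at x) v) S)"

definition smooth_on :: "('a::euclidean_space \<Rightarrow> 'b::real_normed_vector) \<Rightarrow> 'a set \<Rightarrow> bool" where
  "smooth_on f S \<longleftrightarrow> (\<forall>k. Ck_on k f S)"

definition pd1 :: "(real \<times> real \<Rightarrow> real) \<Rightarrow> real \<times> real \<Rightarrow> real" where
  "pd1 F p = deriv (\<lambda>t. F (t, snd p)) (fst p)"

definition pd2 :: "(real \<times> real \<Rightarrow> real) \<Rightarrow> real \<times> real \<Rightarrow> real" where
  "pd2 F p = deriv (\<lambda>t. F (fst p, t)) (snd p)"

definition weight_function :: "(real \<times> real \<Rightarrow> real) \<Rightarrow> bool" where
  "weight_function \<theta> \<longleftrightarrow>
     (\<forall>s\<ge>0. \<forall>t\<ge>0. \<theta> (s, t) \<ge> 0) \<and>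
     continuous_on ({0..} \<times> {0..}) \<theta> \<and>
     smooth_on \<theta> ({0<..} \<times> {0<..}) \<and>
     (\<forall>s>0. \<forall>t>0. \<theta> (s, t) = \<theta> (t, s)) \<and>
     (\<forall>s>0. \<forall>t>0. \<theta> (s, t) > 0)"

text \<open>The probability simplex on the two vertices of \<open>K\<^sub>2\<close>.\<close>

definition simplex2 :: "(real \<times> real) set" where
  "simplex2 = {(p1, p2). p1 + p2 = 1 \<and> p1 \<ge> 0 \<and> p2 \<ge> 0}"

text \<open>The interior of the simplex is meant relative to the line \<open>p1 + p2 = 1\<close>; see
  \<open>rel_interior_simplex2\<close>.\<close>

definition simplex2_interior :: "(real \<times> real) set" where
  "simplex2_interior = {(p1, p2). p1 + p2 = 1 \<and> p1 > 0 \<and> p2 > 0}"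

lemma rel_interior_simplex2: "rel_interior simplex2 = simplex2_interior"
proof -
  have "simplex2 = closed_segment (0, 1) (1, 0)"
    by (auto simp: simplex2_def closed_segment_def algebra_simps)
  moreover have "simplex2_interior = open_segment (0, 1) (1, 0)"
    by (auto simp: simplex2_interior_def in_segment algebra_simps)
  ultimately show ?thesis
    using rel_interior_closed_segment[of "(0::real, 1::real)" "(1, 0)"] by simp
qed

definition kappa :: "(real \<times> real \<Rightarrow> real) \<Rightarrow> (real \<times> real \<Rightarrow> real) \<Rightarrow> real \<times> real \<Rightarrow> real" where
  "kappa \<theta> E p =
     1 / 2 * (pd1 \<theta> p - pd2 \<theta> p) * (pd1 E p - pd2 E p)
     + \<theta> p * (pd1 (pd1 E) p - 2 * pd1 (pd2 E) p + pd2 (pd2 E) p)"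

definition weight_quotient :: "real \<Rightarrow> (real \<times> real \<Rightarrow> real) \<Rightarrow> real \<times> real \<Rightarrow> real" where
  "weight_quotient C E p = 2 * C * ((E p - E (1/2, 1/2)) / (pd1 E p - pd2 E p)\<^sup>2)"

text \<open>\<open>\<theta> = weight_quotient C E\<close> at the point \<open>p\<close> of the simplex, where \<open>E\<close> is smooth on the open
  set \<open>U\<close>. By symmetry of \<open>E\<close> the quotient is always of the form \<open>0/0\<close> at \<open>(1/2, 1/2)\<close>, and at the
  two endpoints the derivatives of \<open>E\<close> need not exist (as for the Boltzmann entropy). At points
  where the quotient is not defined its value is the limit along the simplex.\<close>

definition weight_formula_at ::
  "real \<Rightarrow> (real \<times> real) set \<Rightarrow> (real \<times> real \<Rightarrow> real) \<Rightarrow> (real \<times> real \<Rightarrow> real) \<Rightarrow> real \<times> real \<Rightarrow> bool" where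
  "weight_formula_at C U \<theta> E p \<longleftrightarrow>
     (if p \<in> U \<and> pd1 E p - pd2 E p \<noteq> 0
      then \<theta> p = weight_quotient C E p
      else (weight_quotient C E \<longlongrightarrow> \<theta> p) (at p within simplex2))"

end

theory Submission
  imports Defs
begin

text \<open>Restrict to the simplex: put \<open>e x = E (x, 1 - x)\<close> and \<open>g x = \<theta> (x, 1 - x)\<close>. Then
  \<open>\<kappa> = g' e' / 2 + g e''\<close>, so \<open>(g e'\<^sup>2)' = 2 \<kappa> e'\<close>. Symmetry gives \<open>e' (1/2) = 0\<close>, so \<open>\<kappa> = C\<close>
  integrates to \<open>g e'\<^sup>2 = 2 C (e - e (1/2))\<close>, and this identity differentiates back to \<open>\<kappa> = C\<close>
  wherever \<open>e' \<noteq> 0\<close>. By convexity, a zero of \<open>e'\<close> other than \<open>1/2\<close> makes \<open>e'\<close> vanish on a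
  whole interval; there \<open>\<kappa> = 0\<close>, which forces \<open>C = 0\<close> and \<open>e\<close> constant, while on the other side
  the quotient is identically \<open>0\<close> on that interval, contradicting \<open>\<theta> > 0\<close>.\<close>

section \<open>Partial derivatives of smooth functions on the plane\<close>

text \<open>A derivative at a point of an open set depends only on values inside the set, at every
  order. This carries smoothness from directional Frechet derivatives to \<open>pd1\<close> and
  \<open>pd2\<close>, which are known to agree with them only on \<open>S\<close>.\<close>

lemma Ck_on_cong:
  assumes "open S" "Ck_on k f S" "\<And>x. x \<in> S \<Longrightarrow> f x = g x"
  shows "Ck_on k g S"
  using assms(2,3)
proof (induction k arbitrary: f g)
  case 0
  then show ?case by (simp cong: continuous_on_cong)
next
  case (Suc k)
  have diff: "f differentiable (at x)" if "x \<in> S" for x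
    using Suc.prems(1) that by simp
  have fd: "frechet_derivative f (at x) = frechet_derivative g (at x)" if "x \<in> S" for x
    using frechet_derivative_transform_within_open[OF diff assms(1)] that Suc.prems(2) by blast
  have "g differentiable (at x)" if "x \<in> S" for x
    using diff[OF that] has_derivative_transform_within_open[of f _ x UNIV S g]
      assms(1) that Suc.prems(2)
    unfolding differentiable_def by blast
  moreover have "Ck_on k (\<lambda>x. frechet_derivative g (at x) v) S" for v
    using Suc.IH[of "\<lambda>x. frechet_derivative f (at x) v"] Suc.prems(1) fd by simp
  ultimately show ?case by simp
qed

lemma smooth_on_imp_continuous_on: "smooth_on f S \<Longrightarrow> continuous_on S f"
  unfolding smooth_on_def by (metis Ck_on.simps(1))

lemma smooth_on_has_derivative:
  assumes "smooth_on f S" "p \<in> S"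
  shows "(f has_derivative frechet_derivative f (at p)) (at p)"
  using assms Ck_on.simps(2) unfolding smooth_on_def by (metis frechet_derivative_works)

lemma smooth_on_frechet_derivative:
  "smooth_on f S \<Longrightarrow> smooth_on (\<lambda>x. frechet_derivative f (at x) v) S"
  unfolding smooth_on_def by (metis Ck_on.simps(2))

text \<open>Chain rule in the form used three times: along horizontals, along verticals and along
  the line containing the simplex.\<close>

lemma has_real_derivative_along_path:
  fixes F :: "real \<times> real \<Rightarrow> real"
  assumes "smooth_on F S" "c x \<in> S" "(c has_vector_derivative v) (at x)"
  shows "((\<lambda>t. F (c t)) has_real_derivative frechet_derivative F (at (c x)) v) (at x)"
proof -
  have F: "(F has_derivative frechet_derivative F (at (c x))) (at (c x))"
    using smooth_on_has_derivative[OF assms(1,2)] .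
  have "(F \<circ> c has_derivative frechet_derivative F (at (c x)) \<circ> (\<lambda>h. h *\<^sub>R v)) (at x)"
    using diff_chain_at[of c "\<lambda>h. h *\<^sub>R v" x F] F assms(3)
    by (simp add: has_vector_derivative_def)
  moreover have "frechet_derivative F (at (c x)) \<circ> (\<lambda>h. h *\<^sub>R v)
      = (*) (frechet_derivative F (at (c x)) v)"
    using linear_cmul[OF has_derivative_linear[OF F]] by (auto simp: fun_eq_iff mult.commute)
  ultimately show ?thesis
    by (simp add: has_field_derivative_def o_def)
qed

lemma has_real_derivative_fst:
  fixes F :: "real \<times> real \<Rightarrow> real"
  assumes "smooth_on F S" "(x, y) \<in> S"
  shows "((\<lambda>t. F (t, y)) has_real_derivative frechet_derivative F (at (x, y)) (1, 0)) (at x)"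
  by (rule has_real_derivative_along_path[of F S "\<lambda>t. (t, y)"])
    (use assms in \<open>auto intro!: derivative_eq_intros\<close>)

lemma has_real_derivative_snd:
  fixes F :: "real \<times> real \<Rightarrow> real"
  assumes "smooth_on F S" "(x, y) \<in> S"
  shows "((\<lambda>t. F (x, t)) has_real_derivative frechet_derivative F (at (x, y)) (0, 1)) (at y)"
  by (rule has_real_derivative_along_path[of F S "\<lambda>t. (x, t)"])
    (use assms in \<open>auto intro!: derivative_eq_intros\<close>)

lemma pd1_eq_frechet_derivative:
  assumes "smooth_on F S" "p \<in> S"
  shows "pd1 F p = frechet_derivative F (at p) (1, 0)"
  using has_real_derivative_fst[of F S "fst p" "snd p"] assms
  by (simp add: pd1_def DERIV_imp_deriv)

lemma pd2_eq_frechet_derivative: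
  assumes "smooth_on F S" "p \<in> S"
  shows "pd2 F p = frechet_derivative F (at p) (0, 1)"
  using has_real_derivative_snd[of F S "fst p" "snd p"] assms
  by (simp add: pd2_def DERIV_imp_deriv)

lemma smooth_on_pd1:
  assumes "open S" "smooth_on F S"
  shows "smooth_on (pd1 F) S"
  using Ck_on_cong[OF assms(1)] smooth_on_frechet_derivative[OF assms(2)]
    pd1_eq_frechet_derivative[OF assms(2)]
  unfolding smooth_on_def by metis

lemma smooth_on_pd2:
  assumes "open S" "smooth_on F S"
  shows "smooth_on (pd2 F) S"
  using Ck_on_cong[OF assms(1)] smooth_on_frechet_derivative[OF assms(2)]
    pd2_eq_frechet_derivative[OF assms(2)]
  unfolding smooth_on_def by metis

lemma has_real_derivative_pd1:
  assumes "smooth_on F S" "(x, y) \<in> S"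
  shows "((\<lambda>t. F (t, y)) has_real_derivative pd1 F (x, y)) (at x)"
  using has_real_derivative_fst[OF assms] pd1_eq_frechet_derivative[OF assms] by simp

lemma has_real_derivative_pd2:
  assumes "smooth_on F S" "(x, y) \<in> S"
  shows "((\<lambda>t. F (x, t)) has_real_derivative pd2 F (x, y)) (at y)"
  using has_real_derivative_snd[OF assms] pd2_eq_frechet_derivative[OF assms] by simp

text \<open>Two applications of the mean value theorem: first in the first variable to the
  difference of \<open>f\<close> at heights \<open>b + h\<close> and \<open>b\<close>, then in the
  second variable to \<open>fx\<close>.\<close>

lemma second_difference_mean_value:
  fixes f fx fxy :: "real \<Rightarrow> real \<Rightarrow> real"
  assumes "h > 0"
    and fx: "\<And>x y. \<lbrakk>a \<le> x; x \<le> a + h; b \<le> y; y \<le> b + h\<rbrakk>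
      \<Longrightarrow> ((\<lambda>t. f t y) has_real_derivative fx x y) (at x)"
    and fxy: "\<And>x y. \<lbrakk>a \<le> x; x \<le> a + h; b \<le> y; y \<le> b + h\<rbrakk>
      \<Longrightarrow> ((\<lambda>t. fx x t) has_real_derivative fxy x y) (at y)"
  shows "\<exists>x y. a \<le> x \<and> x \<le> a + h \<and> b \<le> y \<and> y \<le> b + h \<and>
    f (a + h) (b + h) - f (a + h) b - f a (b + h) + f a b = h\<^sup>2 * fxy x y"
proof -
  have "\<exists>z. a < z \<and> z < a + h \<and>
      (f (a + h) (b + h) - f (a + h) b) - (f a (b + h) - f a b)
      = ((a + h) - a) * (fx z (b + h) - fx z b)"
    by (rule MVT2[where f = "\<lambda>t. f t (b + h) - f t b"])
      (use assms(1) in \<open>auto intro!: derivative_eq_intros fx\<close>)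
  then obtain z where z: "a < z" "z < a + h"
    "(f (a + h) (b + h) - f (a + h) b) - (f a (b + h) - f a b) = h * (fx z (b + h) - fx z b)"
    by auto
  have "\<exists>w. b < w \<and> w < b + h \<and> fx z (b + h) - fx z b = ((b + h) - b) * fxy z w"
    by (rule MVT2) (use assms(1) z in \<open>auto intro!: fxy\<close>)
  then obtain w where "b < w" "w < b + h" "fx z (b + h) - fx z b = h * fxy z w"
    by auto
  with z show ?thesis
    by (intro exI[of _ z] exI[of _ w]) (auto simp: power2_eq_square algebra_simps)
qed

text \<open>Schwarz's theorem. The second difference of \<open>F\<close> over a small square is
  \<open>h\<^sup>2\<close> times a value of either mixed partial on that square, and continuity
  keeps these values close to those at the corner \<open>(a, b)\<close>.\<close>

lemma mixed_partials_commute: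
  assumes S: "open S" and F: "smooth_on F S" and p: "(a, b) \<in> S"
  shows "pd2 (pd1 F) (a, b) = pd1 (pd2 F) (a, b)"
proof (rule ccontr)
  let ?A = "pd2 (pd1 F)" and ?B = "pd1 (pd2 F)"
  assume ne: "?A (a, b) \<noteq> ?B (a, b)"
  \<comment> \<open>Half the gap: no number lies within \<open>\<epsilon>\<close> of both
    values.\<close>
  define \<epsilon> where "\<epsilon> = \<bar>?A (a, b) - ?B (a, b)\<bar> / 2"
  have \<epsilon>: "\<epsilon> > 0" using ne by (simp add: \<epsilon>_def)
  note F1 = smooth_on_pd1[OF S F] and F2 = smooth_on_pd2[OF S F]
  have cont: "isCont ?A (a, b)" "isCont ?B (a, b)"
    using smooth_on_imp_continuous_on[OF smooth_on_pd2[OF S F1]]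
      smooth_on_imp_continuous_on[OF smooth_on_pd1[OF S F2]] S p
    by (auto simp: continuous_on_eq_continuous_at)
  have "\<forall>\<^sub>F q in nhds (a, b). q \<in> S \<and> dist (?A q) (?A (a, b)) < \<epsilon> \<and> dist (?B q) (?B (a, b)) < \<epsilon>"
    using cont \<epsilon> S p
    by (intro eventually_conj eventually_nhds_in_open)
      (auto simp: tendsto_iff isCont_def eventually_nhds_conv_at)
  then obtain d where d: "d > 0" and near: "\<And>q. dist q (a, b) < d \<Longrightarrow>
      q \<in> S \<and> dist (?A q) (?A (a, b)) < \<epsilon> \<and> dist (?B q) (?B (a, b)) < \<epsilon>"
    unfolding eventually_nhds_metric by blast
  \<comment> \<open>The square of side \<open>h\<close> has l1-diameter \<open>2 * h < d\<close>, so
    it stays inside the ball.\<close>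
  define h where "h = d / 3"
  have h: "h > 0" using d by (simp add: h_def)
  have box: "dist (x, y) (a, b) < d" if "a \<le> x" "x \<le> a + h" "b \<le> y" "y \<le> b + h" for x y
  proof -
    have "dist (x, y) (a, b) \<le> \<bar>x - a\<bar> + \<bar>y - b\<bar>"
      by (simp add: dist_Pair_Pair dist_real_def sqrt_sum_squares_le_sum_abs)
    also have "\<dots> < d" using that d by (simp add: h_def)
    finally show ?thesis .
  qed
  have "\<exists>x y. a \<le> x \<and> x \<le> a + h \<and> b \<le> y \<and> y \<le> b + h \<and>
      F (a + h, b + h) - F (a + h, b) - F (a, b + h) + F (a, b) = h\<^sup>2 * ?A (x, y)"
    by (rule second_difference_mean_value[of h a b "\<lambda>x y. F (x, y)" "\<lambda>x y. pd1 F (x, y)"])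
      (use h near box has_real_derivative_pd1[OF F] has_real_derivative_pd2[OF F1] in auto)
  then obtain x y where xy: "dist (x, y) (a, b) < d"
    "F (a + h, b + h) - F (a + h, b) - F (a, b + h) + F (a, b) = h\<^sup>2 * ?A (x, y)"
    using box by blast
  \<comment> \<open>The second difference is symmetric in the two variables, so the same lemma with
    their roles exchanged yields the other mixed partial.\<close>
  have "\<exists>y x. b \<le> y \<and> y \<le> b + h \<and> a \<le> x \<and> x \<le> a + h \<and>
      F (a + h, b + h) - F (a, b + h) - F (a + h, b) + F (a, b) = h\<^sup>2 * ?B (x, y)"
    by (rule second_difference_mean_value[of h b a "\<lambda>y x. F (x, y)" "\<lambda>y x. pd2 F (x, y)"])
      (use h near box has_real_derivative_pd2[OF F] has_real_derivative_pd1[OF F2] in auto)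
  then obtain x' y' where xy': "dist (x', y') (a, b) < d"
    "F (a + h, b + h) - F (a, b + h) - F (a + h, b) + F (a, b) = h\<^sup>2 * ?B (x', y')"
    using box by blast
  have "h\<^sup>2 * ?A (x, y) = h\<^sup>2 * ?B (x', y')" using xy(2) xy'(2) by linarith
  hence "?A (x, y) = ?B (x', y')" using h by simp
  with near[OF xy(1)] near[OF xy'(1)] show False
    by (auto simp: \<epsilon>_def dist_real_def abs_if split: if_splits)
qed

text \<open>The line has direction \<open>(1, - 1)\<close>. This turns every difference
  \<open>pd1 - pd2\<close> in \<open>kappa\<close> and in the quotient into an ordinary derivative
  in one variable.\<close>

lemma has_real_derivative_antidiagonal:
  assumes "smooth_on F S" "(x, 1 - x) \<in> S"
  shows "((\<lambda>t. F (t, 1 - t)) has_real_derivative (pd1 F (x, 1 - x) - pd2 F (x, 1 - x))) (at x)"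
proof -
  have "((\<lambda>t. F (t, 1 - t)) has_real_derivative
      frechet_derivative F (at (x, 1 - x)) (1, - 1)) (at x)"
    by (rule has_real_derivative_along_path[of F S "\<lambda>t. (t, 1 - t)"])
      (use assms in \<open>auto intro!: derivative_eq_intros\<close>)
  moreover have "frechet_derivative F (at (x, 1 - x)) (1, - 1)
      = frechet_derivative F (at (x, 1 - x)) (1, 0) - frechet_derivative F (at (x, 1 - x)) (0, 1)"
    using linear_diff[OF has_derivative_linear[OF smooth_on_has_derivative[OF assms]],
        of "(1, 0)" "(0, 1)"] by simp
  ultimately show ?thesis
    using pd1_eq_frechet_derivative[OF assms] pd2_eq_frechet_derivative[OF assms] by simp
qed

section \<open>The equation on the unit interval\<close>

text \<open>One-variable form of the problem, on the open interval because \<open>E\<close> may fail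
  to be differentiable at the endpoints. Continuity of \<open>e''\<close> and \<open>g'\<close>
  serves to recover the curvature at \<open>1/2\<close>, where \<open>e'\<close> vanishes.\<close>

locale symmetric_convex_energy =
  fixes e e' e'' g g' :: "real \<Rightarrow> real"
  assumes e: "\<And>x. x \<in> {0<..<1} \<Longrightarrow> (e has_real_derivative e' x) (at x)"
    and e': "\<And>x. x \<in> {0<..<1} \<Longrightarrow> (e' has_real_derivative e'' x) (at x)"
    and g: "\<And>x. x \<in> {0<..<1} \<Longrightarrow> (g has_real_derivative g' x) (at x)"
    and cont_e'': "continuous_on {0<..<1} e''"
    and cont_g': "continuous_on {0<..<1} g'"
    and g_pos: "\<And>x. x \<in> {0<..<1} \<Longrightarrow> g x > 0"
    and convex: "convex_on {0<..<1} e"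
    and sym: "\<And>x. x \<in> {0<..<1} \<Longrightarrow> e (1 - x) = e x"
begin

definition curv :: "real \<Rightarrow> real" where
  "curv x = 1 / 2 * g' x * e' x + g x * e'' x"

text \<open>The point \<open>1/2\<close> is fixed by the reflection, so differentiating the symmetry
  there gives \<open>- e' (1/2) = e' (1/2)\<close>.\<close>

lemma deriv_half: "e' (1/2) = 0"
proof -
  have "((\<lambda>x. e (1 - x)) has_real_derivative (- e' (1/2))) (at (1/2))"
    by (rule DERIV_chain2[of e "e' (1/2)" "\<lambda>x. 1 - x" "1/2" "- 1" UNIV, simplified])
      (use e[of "1/2"] in \<open>auto intro!: derivative_eq_intros\<close>)
  hence "(e has_real_derivative (- e' (1/2))) (at (1/2))"
    by (rule has_field_derivative_transform_within_open[where S = "{0<..<1}"]) (auto simp: sym)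
  from DERIV_unique[OF this e] show ?thesis by simp
qed

text \<open>Add the two inequalities saying that a convex graph lies above its tangents at
  \<open>x\<close> and at \<open>y\<close>.\<close>

lemma deriv_mono:
  assumes "x \<in> {0<..<1}" "y \<in> {0<..<1}" "x \<le> y"
  shows "e' x \<le> e' y"
proof (cases "x = y")
  case False
  have tangent: "e v - e u \<ge> e' u * (v - u)" if "u \<in> {0<..<1}" "v \<in> {0<..<1}" for u v
    using that
    by (intro convex_on_imp_above_tangent[OF convex])
      (auto simp: interior_open intro: has_field_derivative_at_within[OF e])
  have "(e' y - e' x) * (y - x) \<ge> 0"
    using tangent[of x y] tangent[of y x] assms by (simp add: algebra_simps)
  thus ?thesis using False assms(3) by (simp add: zero_le_mult_iff)
qed simp

text \<open>The monotone function \<open>e'\<close> is squeezed between its zeros at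
  \<open>x\<close> and \<open>1/2\<close>.\<close>

lemma deriv_zero_between_half:
  assumes "x \<in> {0<..<1}" "e' x = 0" "y \<in> closed_segment x (1/2)"
  shows "e' y = 0"
proof -
  consider "x \<le> y" "y \<le> 1/2" | "1/2 \<le> y" "y \<le> x"
    using assms(3) by (auto simp: closed_segment_eq_real_ivl split: if_splits)
  thus ?thesis
    using deriv_mono[of x y] deriv_mono[of y "1/2"] deriv_mono[of y x] deriv_mono[of "1/2" y]
      assms(1,2) deriv_half
    by cases auto
qed

text \<open>The interval strictly between \<open>x\<close> and \<open>1/2\<close>. Being open, it
  lets one differentiate \<open>e' = 0\<close> again, and it gives a whole neighbourhood on which
  the quotient degenerates.\<close>

lemma open_critical_interval:
  assumes "x \<in> {0<..<1}" "x \<noteq> 1/2" "e' x = 0"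
  obtains a b where "a < b" "{a<..<b} \<subseteq> {0<..<1} - {1/2}" "\<And>y. y \<in> {a<..<b} \<Longrightarrow> e' y = 0"
proof
  show "min x (1/2) < max x (1/2)" using assms by auto
  show "{min x (1/2)<..<max x (1/2)} \<subseteq> {0<..<1} - {1/2}" using assms by auto
  show "e' y = 0" if "y \<in> {min x (1/2)<..<max x (1/2)}" for y
    by (rule deriv_zero_between_half[OF assms(1,3)])
      (use that in \<open>auto simp: closed_segment_eq_real_ivl min_def max_def split: if_splits\<close>)
qed

text \<open>The function \<open>G\<close> has derivative \<open>2 * e' y * (curv y - C) = 0\<close>,
  and its constant value is read off at \<open>1/2\<close>, where \<open>e'\<close>
  vanishes.\<close>

lemma first_integral:
  assumes "\<And>x. x \<in> {0<..<1} \<Longrightarrow> curv x = C" "x \<in> {0<..<1}"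
  shows "g x * (e' x)\<^sup>2 = 2 * C * (e x - e (1/2))"
proof -
  define G where "G = (\<lambda>x. g x * (e' x)\<^sup>2 - 2 * C * e x)"
  have "(G has_real_derivative 0) (at y)" if "y \<in> {0<..<1}" for y
  proof -
    have "(G has_real_derivative
        (g' y * (e' y)\<^sup>2 + g y * (2 * e' y * e'' y) - 2 * C * e' y)) (at y)"
      unfolding G_def using e[OF that] e'[OF that] g[OF that]
      by (auto intro!: derivative_eq_intros)
    moreover have "g' y * (e' y)\<^sup>2 + g y * (2 * e' y * e'' y) - 2 * C * e' y
        = 2 * e' y * (curv y - C)"
      by (simp add: curv_def power2_eq_square algebra_simps)
    ultimately show ?thesis using assms(1)[OF that] by simp
  qed
  hence "G x = G (1/2)"
    using DERIV_isconst3[of 0 1 x "1/2" G] assms(2) by auto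
  thus ?thesis by (simp add: G_def deriv_half algebra_simps)
qed

text \<open>Ensures that the first integral can be divided by the square of \<open>e'\<close> away
  from \<open>1/2\<close>. Nonconstancy is essential: for constant \<open>e\<close> the curvature is
  constantly 0 while \<open>e'\<close> vanishes everywhere.\<close>

lemma curv_const_imp_deriv_nonzero:
  assumes curv: "\<And>x. x \<in> {0<..<1} \<Longrightarrow> curv x = C"
    and nonconst: "u \<in> {0<..<1}" "v \<in> {0<..<1}" "e u \<noteq> e v"
    and x: "x \<in> {0<..<1}" "x \<noteq> 1/2"
  shows "e' x \<noteq> 0"
proof
  assume "e' x = 0"
  then obtain a b where ab: "a < b" "{a<..<b} \<subseteq> {0<..<1} - {1/2}"
    and zero: "\<And>y. y \<in> {a<..<b} \<Longrightarrow> e' y = 0"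
    using open_critical_interval[OF x] by metis
  define m where "m = (a + b) / 2"
  have m: "m \<in> {a<..<b}" using ab(1) by (simp add: m_def)
  have m01: "m \<in> {0<..<1}" using m ab(2) by blast
  have "((\<lambda>_. 0) has_real_derivative e'' m) (at m)"
    by (rule has_field_derivative_transform_within_open[OF e'[OF m01], of "{a<..<b}"])
      (use m zero in auto)
  hence "e'' m = 0" using DERIV_unique DERIV_const by metis
  hence "C = 0" using curv[OF m01] zero[OF m] by (simp add: curv_def)
  hence "e' y = 0" if "y \<in> {0<..<1}" for y
    using first_integral[OF curv that] g_pos[OF that] by simp
  hence "e u = e v"
    using DERIV_isconst3[of 0 1 u v e] e nonconst(1,2) by force
  with nonconst(3) show False by simp
qed

text \<open>Differentiating the identity gives \<open>2 * e' y * (curv y - C) = 0\<close>, where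
  \<open>e' y\<close> can be cancelled except at \<open>1/2\<close>.\<close>

lemma first_integral_imp_curv_const:
  assumes int: "\<And>x. x \<in> {0<..<1} \<Longrightarrow> g x * (e' x)\<^sup>2 = 2 * C * (e x - e (1/2))"
    and nz: "\<And>x. x \<in> {0<..<1} \<Longrightarrow> x \<noteq> 1/2 \<Longrightarrow> e' x \<noteq> 0"
    and "x \<in> {0<..<1}"
  shows "curv x = C"
proof -
  have off: "curv y = C" if y: "y \<in> {0<..<1}" "y \<noteq> 1/2" for y
  proof -
    have "((\<lambda>x. g x * (e' x)\<^sup>2) has_real_derivative
        (g' y * (e' y)\<^sup>2 + g y * (2 * e' y * e'' y))) (at y)"
      using e'[OF y(1)] g[OF y(1)] by (auto intro!: derivative_eq_intros)
    moreover have "((\<lambda>x. g x * (e' x)\<^sup>2) has_real_derivative (2 * C * e' y)) (at y)"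
      by (rule has_field_derivative_transform_within_open[where S = "{0<..<1}"
            and f = "\<lambda>x. 2 * C * (e x - e (1/2))"])
        (use e[OF y(1)] y int in \<open>auto intro!: derivative_eq_intros\<close>)
    ultimately have "g' y * (e' y)\<^sup>2 + g y * (2 * e' y * e'' y) = 2 * C * e' y"
      by (rule DERIV_unique)
    hence "2 * e' y * (curv y - C) = 0"
      by (simp add: curv_def power2_eq_square algebra_simps)
    thus ?thesis using nz[OF y] by simp
  qed
  \<comment> \<open>At the midpoint nothing can be cancelled; the value of \<open>curv\<close> is
    obtained there as a limit.\<close>
  have "continuous_on {0<..<1} e'" "continuous_on {0<..<1} g"
    using DERIV_continuous_on[OF has_field_derivative_at_within] e' g by blast+
  hence "continuous_on {0<..<1} curv"
    unfolding curv_def using cont_e'' cont_g' by (intro continuous_intros)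
  hence "isCont curv (1/2)" by (simp add: continuous_on_eq_continuous_at)
  hence "curv \<midarrow>1/2\<rightarrow> curv (1/2)" by (simp add: isCont_def)
  moreover have "\<forall>\<^sub>F y in at (1/2). curv y = C"
    using eventually_at_in_open[of "{0<..<1}" "1/2::real"]
    by (auto elim!: eventually_mono intro: off)
  hence "curv \<midarrow>1/2\<rightarrow> C" by (rule tendsto_eventually)
  ultimately have "curv (1/2) = C" by (rule LIM_unique)
  thus ?thesis using off assms(3) by metis
qed

end

section \<open>The simplex\<close>

lemma antidiagonal_in_simplex2_interior [simp]:
  "(x, 1 - x) \<in> simplex2_interior \<longleftrightarrow> x \<in> {0<..<1}"
  by (auto simp: simplex2_interior_def)

lemma simplex2_interior_cases:
  assumes "p \<in> simplex2_interior"
  obtains x where "p = (x, 1 - x)" "x \<in> {0<..<1}"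
  using assms by (intro that[of "fst p"]) (auto simp: simplex2_interior_def)

lemma simplex2_interior_subset: "simplex2_interior \<subseteq> simplex2"
  by (auto simp: simplex2_interior_def simplex2_def)

text \<open>Finitely many points are negligible for a limit along the simplex, so the midpoint and
  both endpoints, where the quotient may be undefined, can be discarded.\<close>

lemma eventually_at_within_simplex2:
  assumes "\<And>x. x \<in> {0<..<1} \<Longrightarrow> x \<noteq> 1/2 \<Longrightarrow> P (x, 1 - x)"
  shows "eventually P (at p within simplex2)"
proof -
  have "\<forall>\<^sub>F q in at p within simplex2. q \<noteq> (0, 1) \<and> q \<noteq> (1, 0) \<and> q \<noteq> (1/2, 1/2)"
    by (intro eventually_conj eventually_neq_at_within)
  moreover have "\<forall>\<^sub>F q in at p within simplex2. q \<in> simplex2"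
    by (simp add: eventually_at_filter)
  ultimately show ?thesis
  proof eventually_elim
    case (elim q)
    then obtain x where q: "q = (x, 1 - x)" "0 \<le> x" "x \<le> 1"
      by (cases q) (auto simp: simplex2_def)
    with elim have "x \<noteq> 0" "x \<noteq> 1" "x \<noteq> 1/2" by auto
    with q assms show ?case by auto
  qed
qed

text \<open>Needed for uniqueness of limits along the simplex. A connected set with more than one
  point has no isolated points.\<close>

lemma simplex2_at_within_nontrivial:
  assumes "p \<in> simplex2"
  shows "at p within simplex2 \<noteq> bot"
proof -
  have seg: "simplex2 = closed_segment (0, 1) (1, 0)"
    by (auto simp: simplex2_def closed_segment_def algebra_simps)
  have "(0, 1) \<in> simplex2" "(1, 0) \<in> simplex2" by (auto simp: simplex2_def)
  hence "\<nexists>q. simplex2 = {q}" by (metis prod.inject singletonD zero_neq_one)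
  hence "p islimpt simplex2"
    using connected_imp_perfect[of simplex2 p] assms connected_segment seg by metis
  thus ?thesis by (simp add: trivial_limit_within)
qed

text \<open>A constant \<open>E\<close> has to be excluded: its curvature is constantly 0, but its
  quotient is identically 0 on the interior and cannot represent a positive
  \<open>\<theta>\<close>.\<close>

theorem mainTheorem6:
  fixes \<theta> E :: "real \<times> real \<Rightarrow> real" and U :: "(real \<times> real) set" and C :: real
  assumes "weight_function \<theta>"
    and "open U" and "simplex2_interior \<subseteq> U" and "smooth_on E U"
    and "\<forall>(p1, p2)\<in>simplex2. E (p1, p2) = E (p2, p1)"
    and "convex_on simplex2 E"
    and "\<exists>p\<in>simplex2_interior. \<exists>q\<in>simplex2_interior. E p \<noteq> E q"
  shows "(\<forall>p\<in>simplex2_interior. kappa \<theta> E p = C) \<longleftrightarrow>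
         (\<forall>p\<in>simplex2. weight_formula_at C U \<theta> E p)"
proof -
  note U = assms(2) and E = assms(4)
  let ?Q = "{0<..} \<times> {0<..} :: (real \<times> real) set"
  have Q: "open ?Q" by (intro open_Times) auto
  have \<theta>: "smooth_on \<theta> ?Q" and \<theta>_pos: "\<And>s t. s > 0 \<Longrightarrow> t > 0 \<Longrightarrow> \<theta> (s, t) > 0"
    and \<theta>_cont: "continuous_on ({0..} \<times> {0..}) \<theta>"
    using assms(1) by (auto simp: weight_function_def)
  have inU: "(x, 1 - x) \<in> U" if "x \<in> {0<..<1}" for x
    using assms(3) that antidiagonal_in_simplex2_interior by blast
  note E1 = smooth_on_pd1[OF U E] and E2 = smooth_on_pd2[OF U E]
  have on_line: "continuous_on {0<..<1} (\<lambda>x. F (x, 1 - x))"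
    if "smooth_on F S" "\<And>x. x \<in> {0<..<1} \<Longrightarrow> (x, 1 - x) \<in> S" for F :: "real \<times> real \<Rightarrow> real" and S
    by (rule continuous_on_compose2[OF smooth_on_imp_continuous_on[OF that(1)]])
      (use that(2) in \<open>auto intro!: continuous_intros\<close>)

  define e where "e = (\<lambda>x. E (x, 1 - x))"
  define e' where "e' = (\<lambda>x. pd1 E (x, 1 - x) - pd2 E (x, 1 - x))"
  define e'' where "e'' = (\<lambda>x. pd1 (pd1 E) (x, 1 - x) - 2 * pd1 (pd2 E) (x, 1 - x)
    + pd2 (pd2 E) (x, 1 - x))"
  define g where "g = (\<lambda>x. \<theta> (x, 1 - x))"
  define g' where "g' = (\<lambda>x. pd1 \<theta> (x, 1 - x) - pd2 \<theta> (x, 1 - x))"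

  interpret symmetric_convex_energy e e' e'' g g'
  proof
    fix x :: real assume x: "x \<in> {0<..<1}"
    show "(e has_real_derivative e' x) (at x)"
      unfolding e_def e'_def by (rule has_real_derivative_antidiagonal[OF E inU[OF x]])
    \<comment> \<open>Differentiating along the line produces both mixed partials, whereas
      \<open>kappa\<close> contains one of them twice; Schwarz's theorem reconciles the two.\<close>
    have "(e' has_real_derivative
        ((pd1 (pd1 E) (x, 1 - x) - pd2 (pd1 E) (x, 1 - x))
          - (pd1 (pd2 E) (x, 1 - x) - pd2 (pd2 E) (x, 1 - x)))) (at x)"
      unfolding e'_def
      by (intro DERIV_diff has_real_derivative_antidiagonal[OF E1 inU[OF x]]
          has_real_derivative_antidiagonal[OF E2 inU[OF x]])
    thus "(e' has_real_derivative e'' x) (at x)"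
      using mixed_partials_commute[OF U E inU[OF x]] by (simp add: e''_def algebra_simps)
    show "(g has_real_derivative g' x) (at x)"
      unfolding g_def g'_def by (rule has_real_derivative_antidiagonal[OF \<theta>]) (use x in auto)
    show "g x > 0" using x \<theta>_pos by (auto simp: g_def)
    have "(x, 1 - x) \<in> simplex2" using x by (auto simp: simplex2_def)
    with assms(5) show "e (1 - x) = e x" by (auto simp: e_def)
  next
    show "continuous_on {0<..<1} e''"
      unfolding e''_def
      by (intro continuous_intros on_line[OF smooth_on_pd1[OF U E1] inU]
          on_line[OF smooth_on_pd1[OF U E2] inU] on_line[OF smooth_on_pd2[OF U E2] inU])
    show "continuous_on {0<..<1} g'"
      unfolding g'_def
      by (intro continuous_intros on_line[OF smooth_on_pd1[OF Q \<theta>]] on_line[OF smooth_on_pd2[OF Q \<theta>]])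
        auto
    show "convex_on {0<..<1} e"
    proof (rule convex_onI)
      fix t x y :: real
      assume t: "0 < t" "t < 1" and xy: "x \<in> {0<..<1}" "y \<in> {0<..<1}"
      have "E ((1 - t) *\<^sub>R (x, 1 - x) + t *\<^sub>R (y, 1 - y))
          \<le> (1 - t) * E (x, 1 - x) + t * E (y, 1 - y)"
        by (rule convex_onD[OF assms(6)]) (use t xy in \<open>auto simp: simplex2_def\<close>)
      thus "e ((1 - t) *\<^sub>R x + t *\<^sub>R y) \<le> (1 - t) * e x + t * e y"
        by (simp add: e_def algebra_simps)
    qed simp
  qed

  have kappa_line: "kappa \<theta> E (x, 1 - x) = curv x" for x
    unfolding kappa_def curv_def by (simp add: e'_def e''_def g_def g'_def)
  have quotient_line: "weight_quotient C E (x, 1 - x) = 2 * C * ((e x - e (1/2)) / (e' x)\<^sup>2)" for x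
    by (simp add: weight_quotient_def e_def e'_def)

  show ?thesis
  proof
    assume "\<forall>p\<in>simplex2_interior. kappa \<theta> E p = C"
    hence curv: "\<And>x. x \<in> {0<..<1} \<Longrightarrow> curv x = C"
      using kappa_line antidiagonal_in_simplex2_interior by metis
    obtain u v where uv: "u \<in> {0<..<1}" "v \<in> {0<..<1}" "e u \<noteq> e v"
      using assms(7) unfolding e_def by (metis simplex2_interior_cases)
    have nz: "e' x \<noteq> 0" if "x \<in> {0<..<1}" "x \<noteq> 1/2" for x
      using curv_const_imp_deriv_nonzero[OF curv uv] that by blast
    have eq: "weight_quotient C E (x, 1 - x) = \<theta> (x, 1 - x)" if "x \<in> {0<..<1}" "x \<noteq> 1/2" for x
      using first_integral[OF curv that(1)] nz[OF that]
      by (simp add: quotient_line g_def field_simps)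
    show "\<forall>p\<in>simplex2. weight_formula_at C U \<theta> E p"
    proof
      fix p assume p: "p \<in> simplex2"
      \<comment> \<open>One limit serves every point of the closed simplex: \<open>\<theta>\<close>
        is continuous there and agrees with the quotient off three points.\<close>
      have "continuous_on simplex2 \<theta>"
        by (rule continuous_on_subset[OF \<theta>_cont]) (auto simp: simplex2_def)
      hence "(\<theta> \<longlongrightarrow> \<theta> p) (at p within simplex2)"
        using p by (simp add: continuous_on_def)
      moreover have "\<forall>\<^sub>F q in at p within simplex2. \<theta> q = weight_quotient C E q"
        by (rule eventually_at_within_simplex2) (simp add: eq)
      ultimately have lim: "(weight_quotient C E \<longlongrightarrow> \<theta> p) (at p within simplex2)"
        by (rule Lim_transform_eventually)
      \<comment> \<open>Where the quotient is defined it is continuous, so its value equals the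
        limit just found. This includes an endpoint lying in \<open>U\<close> with nonzero
        derivative.\<close>
      have "\<theta> p = weight_quotient C E p" if pU: "p \<in> U" and D: "pd1 E p - pd2 E p \<noteq> 0"
      proof -
        have "isCont E p" "isCont (pd1 E) p" "isCont (pd2 E) p"
          using U pU E E1 E2 smooth_on_imp_continuous_on continuous_on_eq_continuous_at by blast+
        hence "isCont (weight_quotient C E) p"
          unfolding weight_quotient_def using D by (intro continuous_intros) auto
        hence "(weight_quotient C E \<longlongrightarrow> weight_quotient C E p) (at p within simplex2)"
          using continuous_at_imp_continuous_at_within continuous_within by blast
        with lim show ?thesis
          using tendsto_unique simplex2_at_within_nontrivial[OF p] by blast
      qed
      with lim show "weight_formula_at C U \<theta> E p"
        by (simp add: weight_formula_at_def)
    qed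
  next
    assume "\<forall>p\<in>simplex2. weight_formula_at C U \<theta> E p"
    hence formula: "weight_formula_at C U \<theta> E (x, 1 - x)" if "x \<in> {0<..<1}" for x
      using simplex2_interior_subset antidiagonal_in_simplex2_interior that by blast
    have nz: "e' x \<noteq> 0" if x: "x \<in> {0<..<1}" "x \<noteq> 1/2" for x
    proof
      assume "e' x = 0"
      then obtain a b where ab: "a < b" "{a<..<b} \<subseteq> {0<..<1} - {1/2}"
        and zero: "\<And>y. y \<in> {a<..<b} \<Longrightarrow> e' y = 0"
        using open_critical_interval[OF x] by metis
      define m where "m = (a + b) / 2"
      have m: "m \<in> {a<..<b}" using ab(1) by (simp add: m_def)
      have m01: "m \<in> {0<..<1}" using m ab(2) by blast
      let ?F = "at (m, 1 - m) within simplex2"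
      have msimp: "(m, 1 - m) \<in> simplex2" using m01 by (auto simp: simplex2_def)
      \<comment> \<open>Since \<open>e' m = 0\<close>, the formula at this point is its limit
        clause.\<close>
      have "(weight_quotient C E \<longlongrightarrow> g m) ?F"
        using formula[OF m01] zero[OF m] by (simp add: weight_formula_at_def e'_def g_def)
      moreover have "\<forall>\<^sub>F q in ?F. weight_quotient C E q = 0"
      proof -
        \<comment> \<open>This open strip meets the simplex exactly in the critical interval, where
          the denominator is 0 and division by zero returns 0.\<close>
        have "open ({a<..<b} \<times> (UNIV :: real set))" by (intro open_Times) auto
        hence "\<forall>\<^sub>F q in ?F. q \<in> {a<..<b} \<times> UNIV"
          using m by (intro eventually_at_topological[THEN iffD2]) auto
        moreover have "\<forall>\<^sub>F q in ?F. q \<in> simplex2"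
          by (simp add: eventually_at_filter)
        ultimately show ?thesis
        proof eventually_elim
          case (elim q)
          then obtain y where "q = (y, 1 - y)" "y \<in> {a<..<b}"
            by (cases q) (auto simp: simplex2_def)
          thus ?case using zero by (simp add: quotient_line)
        qed
      qed
      hence "(weight_quotient C E \<longlongrightarrow> 0) ?F" by (rule tendsto_eventually)
      ultimately have "g m = 0"
        using tendsto_unique simplex2_at_within_nontrivial[OF msimp] by blast
      with g_pos[OF m01] show False by simp
    qed
    have "g x * (e' x)\<^sup>2 = 2 * C * (e x - e (1/2))" if x: "x \<in> {0<..<1}" for x
    proof (cases "x = 1/2")
      \<comment> \<open>The quotient is \<open>0/0\<close> at the midpoint, but the cross-multiplied
        identity reads \<open>0 = 0\<close>.\<close>
      case True
      show ?thesis unfolding True by (simp add: deriv_half)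
    next
      case False
      have "g x = weight_quotient C E (x, 1 - x)"
        using formula[OF x] nz[OF x False] inU[OF x]
        by (simp add: weight_formula_at_def e'_def g_def)
      thus ?thesis using nz[OF x False] by (simp add: quotient_line field_simps)
    qed
    from first_integral_imp_curv_const[OF this nz]
    have "curv x = C" if "x \<in> {0<..<1}" for x using that by blast
    thus "\<forall>p\<in>simplex2_interior. kappa \<theta> E p = C"
      using kappa_line by (metis simplex2_interior_cases)
  qed
qed

end
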